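(* Let $d\ge 2$ be an integer, $q$ a prime power, $h(x)=ax^d+c\in \mathbb{F}_q[x]$ with $a\neq 0$, and $\beta\in\mathbb{F}_q$. Suppose $q\equiv 1 \pmod r$ for each prime $r\mid d$ and, if $4\mid d$, suppose also $q\equiv 1 \pmod 4$. Then the pair $(h,\beta)$ is dynamically irreducible over $\mathbb{F}_q$ if and only if, for every prime $r\mid d$, - $\frac{-(c-\beta)}{a}$ is not an $r$-th power in $\mathbb{F}_q$, and - $\frac{h^{n-1}(c)-\beta}{a}$ is not an $r$-th power in $\mathbb{F}_q$ for all $n>1$, and, if $4\mid d$, - $\frac{c-\beta}{4a}$ is not a $4$-th power in $\mathbb{F}_q$, and - $\frac{h^{n-1}(c)-\beta}{a}$ is not a $4$-th power in $\mathbb{F}_q$ for all $n>1$.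
   Context: $\mathbb{F}_q$ is the finite field with $q$ elements. For a polynomial $h$, $h^n$ denotes the $n$-fold composition of $h$ with itself. For a polynomial $h\in K[x]$ of degree at least $2$ over a field $K$ and $\beta\in K$, the pair $(h,\beta)$ is dynamically irreducible over $K$ if $h^n(x)-\beta$ is irreducible over $K$ for all positive integers $n$. An $m$-th power in $\mathbb{F}_q$ is an element of the form $y^m$ with $y\in\mathbb{F}_q$ (so $0$ is an $m$-th power). *)

theory Defs
  imports
    "HOL-Computational_Algebra.Computational_Algebra"
    "HOL-Number_Theory.Cong"
    "HOL-Library.Cardinality"
begin

text \<open>The compositional identity is the polynomial \<open>x\<close>, so \<open>poly_iterate h 0 = x\<close>.\<close>

definition poly_iterate :: "'a::comm_semiring_1 poly \<Rightarrow> nat \<Rightarrow> 'a poly" where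
  "poly_iterate h n = (pcompose h ^^ n) [:0, 1:]"

text \<open>Intended for polynomials of degree at least 2. The base field is the coefficient type.\<close>

definition dynamically_irreducible :: "'a::field poly \<Rightarrow> 'a \<Rightarrow> bool" where
  "dynamically_irreducible h \<beta> \<longleftrightarrow> (\<forall>n>0. irreducible (poly_iterate h n - [:\<beta>:]))"

end

theory Submission
  imports "HOL-Algebra.Algebraic_Closure_Type" "HOL-Number_Theory.Residues" Defs
begin

text \<open>Let \<open>\<phi>(x) = x\<^sup>q\<close> on the algebraic closure. A polynomial of degree \<open>D\<close> over the field with \<open>q\<close>
  elements is irreducible iff \<open>D\<close> is the exact \<open>\<phi>\<close>-period of one (equivalently each) of its roots.
  Follow a backward orbit \<open>h(t\<^sub>n\<^sub>+\<^sub>1) = t\<^sub>n\<close>, \<open>t\<^sub>0 = \<beta>\<close>: dynamical irreducibility says that \<open>t\<^sub>n\<close> has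
  period \<open>d\<^sup>n\<close> for all \<open>n\<close>. Since \<open>t\<^sub>n\<^sub>+\<^sub>1\<close> is a \<open>d\<close>-th root of \<open>u = (t\<^sub>n - c) / a\<close>, the period grows by
  the full factor \<open>d\<close> iff \<open>u\<close> is not an \<open>r\<close>-th power in its field for any prime \<open>r\<close> dividing \<open>d\<close>. By
  Euler's criterion this can be read off the norm of \<open>u\<close>, which up to \<open>r\<close>-th powers is
  \<open>(h\<^sup>n(c) - \<beta>) / a\<close>, or \<open>- (c - \<beta>) / a\<close> for \<open>n = 0\<close>.\<close>

hide_const (open) Divisibility.prime Divisibility.irreducible

section \<open>Mapping the coefficients of polynomials\<close>

lemma map_poly_add_hom:
  fixes f :: "'a::comm_semiring_1 \<Rightarrow> 'b::comm_semiring_1"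
  assumes "f 0 = 0" "\<And>x y. f (x + y) = f x + f y"
  shows "map_poly f (p + q) = map_poly f p + map_poly f q"
  by (intro poly_eqI) (simp add: coeff_map_poly assms)

text \<open>Stated for any map that respects the ring operations, since it is applied both to the
  embedding \<open>to_ac\<close> and to \<phi> acting on coefficients.\<close>

lemma map_poly_mult_hom:
  fixes f :: "'a::comm_semiring_1 \<Rightarrow> 'b::comm_semiring_1"
  assumes "f 0 = 0" "\<And>x y. f (x + y) = f x + f y" "\<And>x y. f (x * y) = f x * f y"
  shows "map_poly f (p * q) = map_poly f p * map_poly f q"
proof (induction p)
  case (pCons a p)
  then show ?case
    by (simp add: map_poly_add_hom map_poly_smult map_poly_pCons assms)
qed simp

lemma map_poly_prod_hom:
  fixes f :: "'a::comm_semiring_1 \<Rightarrow> 'b::comm_semiring_1"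
  assumes "f 0 = 0" "f 1 = 1" "\<And>x y. f (x + y) = f x + f y" "\<And>x y. f (x * y) = f x * f y"
  shows "map_poly f (\<Prod>i\<in>A. p i) = (\<Prod>i\<in>A. map_poly f (p i))"
  by (induction A rule: infinite_finite_induct) (simp_all add: map_poly_mult_hom assms)

lemma map_poly_to_ac_mult:
  "map_poly to_ac (p * q) = map_poly to_ac p * map_poly to_ac q"
  by (intro map_poly_mult_hom) simp_all

lemma degree_map_poly_to_ac [simp]: "degree (map_poly to_ac p) = degree p"
  by (intro degree_map_poly) simp

lemma poly_map_poly_to_ac [simp]: "poly (map_poly to_ac p) (to_ac x) = to_ac (poly p x)"
  by (induction p) (simp_all add: map_poly_pCons)

section \<open>The Frobenius map on the algebraic closure\<close>

text \<open>Multiplication by a nonzero \<open>x\<close> permutes the nonzero elements, so their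
  product can be cancelled.\<close>

lemma fermat_finite_field:
  fixes x :: "'a::{field,finite}"
  shows "x ^ CARD('a) = x"
proof (cases "x = 0")
  case False
  have "x * (\<Prod>y\<in>UNIV-{0}. x * y) = x * x ^ (CARD('a) - 1) * \<Prod>(UNIV-{0})"
    by (simp add: prod.distrib mult_ac)
  also have "x * x ^ (CARD('a) - 1) = x ^ CARD('a)"
    by (metis finite_UNIV_card_ge_0 finite power_eq_if neq0_conv)
  also have "(\<Prod>y\<in>UNIV-{0}. x * y) = (\<Prod>y\<in>UNIV-{0}. y)"
    by (rule prod.reindex_bij_witness[of _ "\<lambda>y. y / x" "\<lambda>y. x * y"]) (use False in auto)
  finally show ?thesis
    by simp
qed simp

lemma CARD_field_ge_2: "CARD('a::{field,finite}) \<ge> 2"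
proof -
  have "card {0, 1 :: 'a} \<le> CARD('a)"
    by (intro card_mono) auto
  then show ?thesis by simp
qed

lemma to_ac_power_CARD [simp]:
  fixes x :: "'a::{field,finite}"
  shows "to_ac x ^ CARD('a) = to_ac x"
  by (metis fermat_finite_field to_ac_power)

lemma card_range_to_ac: "card (range (to_ac :: 'a::{field,finite} \<Rightarrow> _)) = CARD('a)"
  by (simp add: card_image inj_to_ac)

text \<open>The polynomial \<open>(X + 1)\<^sup>q - X\<^sup>q - 1\<close> has degree less than \<open>q\<close> and vanishes on all
  \<open>q\<close> elements of the base field, so it is zero. This makes the Frobenius map additive without
  knowing that \<open>q\<close> is a prime power.\<close>

lemma power_CARD_add_one:
  fixes x :: "'a::{field,finite} alg_closure"
  shows "(x + 1) ^ CARD('a) = x ^ CARD('a) + 1"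
proof -
  let ?q = "CARD('a)"
  let ?L = "[:1, 1 :: 'a alg_closure:] ^ ?q" and ?R = "monom (1 :: 'a alg_closure) ?q + 1"
  have q: "?q > 1"
    using CARD_field_ge_2[where ?'a = 'a] by linarith
  have deg: "degree ?L = ?q"
    by (simp add: degree_power_eq)
  have degR: "degree ?R = ?q"
    using q by (subst degree_add_eq_left) (simp_all add: degree_monom_eq)
  have lc: "coeff ?L ?q = 1"
    using lead_coeff_power[of "[:1, 1 :: 'a alg_closure:]" ?q] deg by simp
  have "?L = ?R"
  proof (rule poly_eqI_degree_lead_coeff[where n = ?q and A = "range (to_ac :: 'a \<Rightarrow> _)"])
    show "coeff ?L ?q = coeff ?R ?q"
      using lc q by (simp add: coeff_1)
    show "card (range (to_ac :: 'a \<Rightarrow> _)) \<ge> ?q"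
      by (simp add: card_range_to_ac)
    show "poly ?L z = poly ?R z" if "z \<in> range (to_ac :: 'a \<Rightarrow> _)" for z
    proof -
      from that obtain y where y: "z = to_ac y" by auto
      have "(z + 1) ^ ?q = to_ac (y + 1) ^ ?q"
        by (simp add: y)
      also have "\<dots> = to_ac y ^ ?q + 1"
        by (simp only: to_ac_power_CARD) simp
      finally show ?thesis
        by (simp add: y poly_monom add.commute)
    qed
  qed (use deg degR in auto)
  from arg_cong[OF this, of "\<lambda>p. poly p x"] show ?thesis
    by (simp add: poly_monom add.commute)
qed

text \<open>Dividing by a nonzero \<open>y\<close> reduces the claim to the case
  \<open>y = 1\<close>.\<close>

lemma power_CARD_add:
  fixes x y :: "'a::{field,finite} alg_closure"
  shows "(x + y) ^ CARD('a) = x ^ CARD('a) + y ^ CARD('a)"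
proof (cases "y = 0")
  case False
  then have "x + y = (x / y + 1) * y"
    by (simp add: field_simps)
  then have "(x + y) ^ CARD('a) = ((x / y) ^ CARD('a) + 1) * y ^ CARD('a)"
    by (simp only: power_mult_distrib power_CARD_add_one)
  then show ?thesis
    using False by (simp add: field_simps)
qed simp

section \<open>Geometric sums and roots of unity of prime order\<close>

lemma prod_power_distinct_powers:
  fixes x :: "'b::comm_monoid_mult" and n :: nat
  shows "(\<Prod>i<n. x ^ (f i)) = x ^ (\<Sum>i<n. f i)"
  by (induction n) (simp_all add: power_add)

lemma nat_power_diff_1_eq: "(Q :: nat) ^ r - 1 = (Q - 1) * (\<Sum>i<r. Q ^ i)"
proof (cases "Q = 0")
  case False
  have "int (Q ^ r - 1) = int ((Q - 1) * (\<Sum>i<r. Q ^ i))"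
    using power_diff_1_eq[of "int Q" r] False
    by (cases "Q = 1") (simp_all add: of_nat_diff Suc_leI)
  then show ?thesis
    by (simp only: of_nat_eq_iff)
qed (cases r; simp)

text \<open>For odd \<open>r\<close> the exponent is a multiple of \<open>r\<close>; for
  \<open>r = 2\<close> it is 1 and \<open>z = - 1\<close>. This is the sign that appears in the norm
  of an \<open>r\<close>-th root.\<close>

lemma root_of_unity_power_triangle:
  fixes z :: "'b::field"
  assumes r: "prime r" and z: "z ^ r = 1" "z \<noteq> 1"
  shows "z ^ (\<Sum>i<r. i) = (- 1) ^ (r - 1)"
proof (cases "r = 2")
  case True
  then have "(z - 1) * (z + 1) = 0"
    using z by (simp add: algebra_simps power2_eq_square)
  then have "z = - 1"
    using z by (simp add: eq_neg_iff_add_eq_0)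
  then show ?thesis
    using True by (simp add: numeral_2_eq_2)
next
  case False
  then have "odd r"
    using r using prime_odd_nat[of r] prime_ge_2_nat[of r] by linarith
  then obtain m where m: "r = 2 * m + 1"
    by (elim oddE)
  have "(\<Sum>i<r. i) = r * m"
    using Sum_Ico_nat[of 0 r] by (simp add: m atLeast0LessThan)
  then have "z ^ (\<Sum>i<r. i) = 1"
    using z by (simp add: power_mult)
  then show ?thesis
    using m by simp
qed

text \<open>If \<open>j\<close> were coprime to \<open>r\<close>, Bezout would express
  \<open>z\<close> through \<open>z ^ j\<close> and \<open>z ^ r\<close> and give
  \<open>z = 1\<close>.\<close>

lemma order_dvd_of_prime_power_eq_1:
  fixes z :: "'b::field"
  assumes r: "prime r" and z: "z ^ r = 1" "z \<noteq> 1" and j: "z ^ j = 1"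
  shows "r dvd j"
proof (rule ccontr)
  assume "\<not> r dvd j"
  then have "coprime j r"
    using r prime_imp_coprime coprime_commute by blast
  moreover have "j \<noteq> 0"
    using \<open>\<not> r dvd j\<close> by (metis dvd_0_right)
  ultimately obtain u v where "j * u = r * v + 1"
    using bezout_nat[of j r] by (auto simp: coprime_iff_gcd_eq_1)
  then have "z ^ (j * u) = z ^ (r * v) * z"
    by simp
  then show False
    using z j by (simp add: power_mult)
qed

section \<open>Periods under Frobenius\<close>

text \<open>This period is the degree of \<open>x\<close> over the base field. Encoding it by powers
  keeps every argument inside the algebraic closure, with no intermediate fields to
  construct.\<close>

definition frob_degree :: "'a::{field,finite} alg_closure \<Rightarrow> nat \<Rightarrow> bool" where
  "frob_degree x D \<longleftrightarrow> D > 0 \<and> x ^ (CARD('a) ^ D) = x \<and>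
    (\<forall>k. 0 < k \<and> k < D \<longrightarrow> x ^ (CARD('a) ^ k) \<noteq> x)"

context
  fixes q :: nat
  defines "q \<equiv> CARD('a::{field,finite})"
begin

lemma frob_add: "(x + y :: 'a alg_closure) ^ (q ^ k) = x ^ (q ^ k) + y ^ (q ^ k)"
proof (induction k)
  case (Suc k)
  have "(x + y) ^ (q ^ Suc k) = ((x + y) ^ (q ^ k)) ^ q"
    by (simp only: power_Suc2 power_mult)
  also have "\<dots> = (x ^ (q ^ k)) ^ q + (y ^ (q ^ k)) ^ q"
    by (simp only: Suc.IH) (simp only: q_def power_CARD_add)
  finally show ?case
    by (simp only: power_Suc2 power_mult)
qed simp

lemma frob_minus: "(- x :: 'a alg_closure) ^ (q ^ k) = - (x ^ (q ^ k))"
proof -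
  have "q > 0"
    by (simp add: q_def)
  then have "0 = (x + (- x)) ^ (q ^ k)"
    by simp
  also have "\<dots> = x ^ (q ^ k) + (- x) ^ (q ^ k)"
    by (rule frob_add)
  finally show ?thesis
    by (metis add_eq_0_iff)
qed

lemma frob_diff: "(x - y :: 'a alg_closure) ^ (q ^ k) = x ^ (q ^ k) - y ^ (q ^ k)"
  using frob_add[of x "- y" k] frob_minus[of y k] by simp

lemma frob_inj: "(x :: 'a alg_closure) ^ (q ^ k) = y ^ (q ^ k) \<longleftrightarrow> x = y"
  using frob_diff[of x y k] by (auto simp: q_def)

lemma frob_to_ac [simp]: "to_ac (x :: 'a) ^ (q ^ k) = to_ac x"
  by (induction k) (simp_all add: power_mult q_def)

lemma frob_poly:
  fixes f :: "'a poly"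
  shows "poly (map_poly to_ac f) x ^ (q ^ k) = poly (map_poly to_ac f) (x ^ (q ^ k))"
proof (induction f)
  case 0
  show ?case by (simp add: q_def)
next
  case (pCons a f)
  then show ?case
    by (simp add: map_poly_pCons frob_add power_mult_distrib)
qed

lemma frob_root:
  fixes f :: "'a poly"
  assumes "poly (map_poly to_ac f) x = 0"
  shows "poly (map_poly to_ac f) (x ^ (q ^ k)) = 0"
proof -
  have "(0 :: 'a alg_closure) ^ (q ^ k) = 0"
    by (simp add: q_def power_0_left)
  then show ?thesis
    using frob_poly[of f x k] assms by metis
qed

text \<open>The polynomial \<open>X ^ q - X\<close> has at most \<open>q\<close> roots, and the
  \<open>q\<close> elements of the base field already are roots.\<close>

lemma frob_fixed_iff: "(x :: 'a alg_closure) ^ q = x \<longleftrightarrow> x \<in> range to_ac"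
proof
  let ?p = "monom (1 :: 'a alg_closure) q + [:0, - 1:]"
  let ?R = "{x :: 'a alg_closure. poly ?p x = 0}"
  have q: "q > 1"
    using CARD_field_ge_2[where ?'a = 'a] by (simp add: q_def)
  have deg: "degree ?p = q"
    using q by (subst degree_add_eq_left) (simp_all add: degree_monom_eq)
  then have "?p \<noteq> 0"
    using q by force
  then have fin: "finite ?R" and "card ?R \<le> q"
    using poly_roots_finite[of ?p] card_poly_roots_bound[of ?p] deg by (simp_all del: poly_add)
  moreover have sub: "range (to_ac :: 'a \<Rightarrow> _) \<subseteq> ?R"
    by (auto simp: poly_monom q_def)
  ultimately have "range (to_ac :: 'a \<Rightarrow> _) = ?R"
    by (intro card_seteq) (auto simp: card_range_to_ac q_def)
  moreover assume "x ^ q = x"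
  ultimately show "x \<in> range to_ac"
    by (simp add: poly_monom)
qed (auto simp: q_def)

lemma frob_funpow: "(x :: 'a alg_closure) ^ (q ^ D) = x \<Longrightarrow> x ^ (q ^ (D * j)) = x"
  by (induction j) (simp_all add: power_add power_mult)

text \<open>The remainder of \<open>k\<close> modulo \<open>D\<close> again fixes \<open>x\<close>,
  so minimality of \<open>D\<close> forces it to be 0.\<close>

lemma frob_degree_dvd:
  assumes "frob_degree (x :: 'a alg_closure) D" "x ^ (q ^ k) = x"
  shows "D dvd k"
proof -
  have D: "D > 0" "x ^ (q ^ D) = x" and min: "\<And>k. 0 < k \<Longrightarrow> k < D \<Longrightarrow> x ^ (q ^ k) \<noteq> x"
    using assms(1) by (auto simp: frob_degree_def q_def)
  have "x ^ (q ^ k) = x ^ (q ^ (D * (k div D) + k mod D))"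
    by simp
  also have "\<dots> = (x ^ (q ^ (D * (k div D)))) ^ (q ^ (k mod D))"
    by (simp only: power_add power_mult)
  also have "\<dots> = x ^ (q ^ (k mod D))"
    by (simp only: frob_funpow D)
  finally have "x ^ (q ^ (k mod D)) = x"
    using assms(2) by simp
  with min[of "k mod D"] D(1) have "k mod D = 0"
    by (metis gr0I mod_less_divisor)
  then show ?thesis
    by auto
qed

lemma frob_degreeI:
  assumes "D > 0" "(x :: 'a alg_closure) ^ (q ^ D) = x" "\<And>k. x ^ (q ^ k) = x \<Longrightarrow> D dvd k"
  shows "frob_degree x D"
  using assms by (force simp: frob_degree_def q_def dest: dvd_imp_le)

lemma frob_coincide:
  assumes "(x :: 'a alg_closure) ^ (q ^ i) = x ^ (q ^ j)" "i \<le> j"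
  shows "x ^ (q ^ (j - i)) = x"
proof -
  have "(x ^ (q ^ (j - i))) ^ (q ^ i) = x ^ (q ^ (j - i + i))"
    by (simp only: power_add power_mult)
  also have "\<dots> = x ^ (q ^ i)"
    using assms by simp
  finally show ?thesis
    by (simp only: frob_inj)
qed

lemma frob_degree_inj_on:
  assumes "\<And>k. 0 < k \<Longrightarrow> k < D \<Longrightarrow> (x :: 'a alg_closure) ^ (q ^ k) \<noteq> x"
  shows "inj_on (\<lambda>i. x ^ (q ^ i)) {..<D}"
proof (rule linorder_inj_onI)
  fix i j assume ij: "i < j" "i \<in> {..<D}" "j \<in> {..<D}"
  show "x ^ (q ^ i) \<noteq> x ^ (q ^ j)"
  proof
    assume "x ^ (q ^ i) = x ^ (q ^ j)"
    then have "x ^ (q ^ (j - i)) = x"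
      using ij by (intro frob_coincide) auto
    moreover have "0 < j - i" "j - i < D"
      using ij by auto
    ultimately show False
      using assms by blast
  qed
qed auto

text \<open>Pigeonhole on \<open>card R + 1\<close> iterates, followed by cancelling the injective
  \<phi>. The stride \<open>D\<close> makes the bound usable over the field with
  \<open>q ^ D\<close> elements too, not only over the base field.\<close>

lemma frob_coincide_if_finite:
  assumes "finite R" "\<And>i. (x :: 'a alg_closure) ^ (q ^ (D * i)) \<in> R"
  shows "\<exists>j. 0 < j \<and> j \<le> card R \<and> x ^ (q ^ (D * j)) = x"
proof -
  have "\<not> inj_on (\<lambda>i. x ^ (q ^ (D * i))) {..card R}"
  proof
    assume "inj_on (\<lambda>i. x ^ (q ^ (D * i))) {..card R}"
    then have "card {..card R} \<le> card R"
      by (rule card_inj_on_le) (use assms in auto)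
    then show False by simp
  qed
  then obtain i j where ij: "i < j" "j \<le> card R" "x ^ (q ^ (D * i)) = x ^ (q ^ (D * j))"
    by (metis atMost_iff linorder_inj_onI' )
  then have "x ^ (q ^ (D * (j - i))) = x"
    by (simp add: frob_coincide right_diff_distrib')
  with ij show ?thesis
    by (intro exI[of _ "j - i"]) auto
qed

text \<open>\<phi> maps roots of \<open>f\<close> to roots of \<open>f\<close>, and there are at
  most \<open>degree f\<close> of them.\<close>

lemma frob_degree_exists:
  assumes "poly (map_poly to_ac f) (x :: 'a alg_closure) = 0" "f \<noteq> 0"
  shows "\<exists>D \<le> degree f. frob_degree x D"
proof -
  let ?R = "{x. poly (map_poly to_ac f) x = 0}"
  have nz: "map_poly to_ac f \<noteq> 0"
    using assms(2) by (simp add: map_poly_eq_0_iff)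
  have card: "card ?R \<le> degree f"
    using card_poly_roots_bound[OF nz] by simp
  have "x ^ (q ^ (1 * i)) \<in> ?R" for i
    using frob_root[OF assms(1)] by simp
  from frob_coincide_if_finite[OF poly_roots_finite[OF nz] this]
  obtain j where j: "0 < j" "j \<le> card ?R" "x ^ (q ^ j) = x"
    by auto
  define D where "D = (LEAST k. 0 < k \<and> x ^ (q ^ k) = x)"
  have "0 < D \<and> x ^ (q ^ D) = x"
    unfolding D_def by (rule LeastI[of _ j]) (use j in auto)
  moreover have "D \<le> j"
    unfolding D_def by (rule Least_le) (use j in auto)
  moreover have "\<not> (0 < k \<and> x ^ (q ^ k) = x)" if "k < D" for k
    using that unfolding D_def by (rule not_less_Least)
  ultimately show ?thesis
    using j card by (intro exI[of _ D]) (auto simp: frob_degree_def q_def)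
qed

section \<open>Conjugates, minimal polynomials and irreducibility\<close>

text \<open>The conjugates of \<open>x\<close> are \<open>degree f\<close> distinct roots of both
  sides, and the leading coefficients agree.\<close>

lemma map_poly_to_ac_eq_prod_conjugates:
  fixes f :: "'a poly"
  assumes root: "poly (map_poly to_ac f) x = 0" and deg: "frob_degree x (degree f)"
  shows "map_poly to_ac f = smult (to_ac (lead_coeff f)) (\<Prod>i<degree f. [:- (x ^ (q ^ i)), 1:])"
    (is "_ = ?R")
proof -
  let ?A = "(\<lambda>i. x ^ (q ^ i)) ` {..<degree f}"
  have inj: "inj_on (\<lambda>i. x ^ (q ^ i)) {..<degree f}"
    using deg by (intro frob_degree_inj_on) (auto simp: frob_degree_def q_def)
  have "f \<noteq> 0"
    using deg by (auto simp: frob_degree_def)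
  then have degR: "degree ?R = degree f"
    by (simp add: degree_prod_sum_eq)
  have "lead_coeff (\<Prod>i<degree f. [:- (x ^ (q ^ i)), 1:]) = 1"
    by (simp add: lead_coeff_prod)
  then have "coeff ?R (degree f) = to_ac (lead_coeff f)"
    using degR lead_coeff_smult[of "to_ac (lead_coeff f)" "\<Prod>i<degree f. [:- (x ^ (q ^ i)), 1:]"] 
    by simp
  then have "coeff (map_poly to_ac f) (degree f) = coeff ?R (degree f)"
    by (simp add: coeff_map_poly)
  moreover have "poly (map_poly to_ac f) z = poly ?R z" if "z \<in> ?A" for z
  proof -
    have "poly (map_poly to_ac f) z = 0"
      using that frob_root[OF root] by auto
    moreover have "poly ?R z = 0"
      using that by (auto simp: poly_prod)
    ultimately show ?thesis by simp
  qed
  moreover have "card ?A \<ge> degree f"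
    using inj by (simp add: card_image)
  ultimately show ?thesis
    using degR by (intro poly_eqI_degree_lead_coeff[where n = "degree f" and A = ?A]) auto
qed

text \<open>The product of the linear factors of all conjugates works: \<phi> permutes these
  factors, hence fixes the coefficients, which therefore lie in the base field.\<close>

lemma minimal_poly_exists:
  assumes deg: "frob_degree (x :: 'a alg_closure) D"
  shows "\<exists>g :: 'a poly. degree g = D \<and> poly (map_poly to_ac g) x = 0"
proof -
  let ?P = "\<lambda>k. \<Prod>i<D. [:- (x ^ (q ^ (i + k))), 1:]"
  have D: "D > 0" "x ^ (q ^ D) = x"
    using deg by (auto simp: frob_degree_def q_def)
  have hom: "map_poly (\<lambda>y :: 'a alg_closure. y ^ q) (?P 0) = ?P 1"
  proof -
    have "q > 0" by (simp add: q_def)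
    then have "map_poly (\<lambda>y :: 'a alg_closure. y ^ q) (?P 0)
        = (\<Prod>i<D. map_poly (\<lambda>y. y ^ q) [:- (x ^ (q ^ (i + 0))), 1:])"
      using frob_add[of _ _ 1] by (intro map_poly_prod_hom) (auto simp: power_mult_distrib)
    also have "\<dots> = ?P 1"
      using frob_minus[of _ 1] \<open>q > 0\<close>
      by (intro prod.cong refl) (simp add: map_poly_pCons mult.commute flip: power_mult)
    finally show ?thesis .
  qed
  \<comment> \<open>The shifted product has exponents 1 to \<open>D\<close>. Since \<open>D\<close>
    is a period of \<open>x\<close>, its last factor is the missing factor with exponent 0.\<close>
  also have "?P 1 = (\<Prod>i\<in>{1..D}. [:- (x ^ (q ^ i)), 1:])"
    by (rule prod.reindex_bij_witness[of _ "\<lambda>i. i - 1" "\<lambda>i. i + 1"]) auto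
  also have "\<dots> = [:- (x ^ (q ^ D)), 1:] * (\<Prod>i\<in>{1..<D}. [:- (x ^ (q ^ i)), 1:])"
  proof -
    have "{1..D} = insert D {1..<D}"
      using D by auto
    then show ?thesis
      by simp
  qed
  also have "\<dots> = [:- (x ^ (q ^ 0)), 1:] * (\<Prod>i\<in>{1..<D}. [:- (x ^ (q ^ i)), 1:])"
    using D by simp
  also have "\<dots> = ?P 0"
  proof -
    have "{..<D} = insert 0 {1..<D}"
      using D by auto
    then show ?thesis
      by simp
  qed
  finally have fixed: "map_poly (\<lambda>y :: 'a alg_closure. y ^ q) (?P 0) = ?P 0" .
  have "coeff (?P 0) n \<in> range (to_ac :: 'a \<Rightarrow> _)" for n
  proof -
    have "coeff (?P 0) n ^ q = coeff (?P 0) n"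
      using arg_cong[OF fixed, of "\<lambda>p. coeff p n"] by (subst (asm) coeff_map_poly) (auto simp: q_def)
    then show ?thesis
      by (simp only: frob_fixed_iff)
  qed
  note coeffs = to_ac_of_ac[OF this]
  define g where "g = map_poly of_ac (?P 0)"
  have g: "map_poly to_ac g = ?P 0"
    by (rule poly_eqI) (simp add: g_def coeff_map_poly coeffs[simplified])
  have "degree g = degree (?P 0)"
    by (metis g degree_map_poly_to_ac)
  also have "\<dots> = D"
    by (simp add: degree_prod_sum_eq)
  finally show ?thesis
    using D by (intro exI[of _ g]) (auto simp: g poly_prod intro!: bexI[of _ 0])
qed

lemma irreducible_iff_frob_degree:
  fixes f :: "'a poly"
  assumes root: "poly (map_poly to_ac f) x = 0" and f: "f \<noteq> 0"
  shows "irreducible f \<longleftrightarrow> frob_degree x (degree f)"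
proof
  assume irr: "irreducible f"
  obtain D where D: "D \<le> degree f" "frob_degree x D"
    using frob_degree_exists[OF root f] by auto
  obtain g :: "'a poly" where g: "degree g = D" "poly (map_poly to_ac g) x = 0"
    using minimal_poly_exists[OF D(2)] by auto
  have "g \<noteq> 0"
    using g D by (auto simp: frob_degree_def)
  \<comment> \<open>A nonzero remainder would vanish at \<open>x\<close> and have degree below
    \<open>D\<close>, while every period of \<open>x\<close> is a multiple of
    \<open>D\<close>.\<close>
  have "f mod g = 0"
  proof (rule ccontr)
    assume nz: "f mod g \<noteq> 0"
    have "f = f div g * g + f mod g"
      by simp
    then have "poly (map_poly to_ac (f div g * g + f mod g)) x = 0"
      using root by simp
    then have "poly (map_poly to_ac (f mod g)) x = 0"
      by (simp only: map_poly_add_hom[OF to_ac_0 to_ac_add] map_poly_to_ac_mult poly_add poly_mult g)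
        simp
    from frob_degree_exists[OF this nz] obtain E where E: "E \<le> degree (f mod g)" "frob_degree x E"
      by auto
    then have "D dvd E" "E > 0"
      using frob_degree_dvd[OF D(2)] by (auto simp: frob_degree_def q_def)
    moreover have "degree (f mod g) < D"
      using degree_mod_less[OF \<open>g \<noteq> 0\<close>, of f] nz g by simp
    ultimately show False
      using E by (auto dest!: dvd_imp_le)
  qed
  then obtain h where h: "f = g * h"
    by auto
  have "\<not> is_unit g"
    using D g \<open>g \<noteq> 0\<close> by (simp add: is_unit_iff_degree frob_degree_def)
  then have "is_unit h"
    using irr h by (auto dest: irreducibleD)
  then have "degree f = D"
    using h f g by (auto simp: degree_mult_eq is_unit_iff_degree)
  with D show "frob_degree x (degree f)"
    by simp
next
  assume deg: "frob_degree x (degree f)"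
  have deg0: "degree f > 0"
    using deg by (auto simp: frob_degree_def)
  \<comment> \<open>A factor vanishing at \<open>x\<close> has degree at least the period of
    \<open>x\<close>, so the factor that carries the root leaves degree 0 for the other.\<close>
  have factor: "degree g \<ge> degree f" if "g dvd f" "poly (map_poly to_ac g) x = 0" for g
  proof -
    have "g \<noteq> 0"
      using that f by auto
    from frob_degree_exists[OF that(2) this] obtain D where "D \<le> degree g" "frob_degree x D"
      by auto
    moreover from this have "degree f dvd D"
      by (intro frob_degree_dvd[OF deg]) (auto simp: frob_degree_def q_def)
    ultimately show ?thesis
      by (auto simp: frob_degree_def dest!: dvd_imp_le)
  qed
  show "irreducible f"
  proof (rule irreducibleI)
    show "\<not> is_unit f"
      using deg0 by (auto simp: is_unit_iff_degree f)
  next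
    fix g h assume gh: "f = g * h"
    then have nz: "g \<noteq> 0" "h \<noteq> 0"
      using f by auto
    have "degree f = degree g + degree h"
      using nz gh by (simp add: degree_mult_eq)
    moreover have "poly (map_poly to_ac g) x = 0 \<or> poly (map_poly to_ac h) x = 0"
      using root gh by (simp add: map_poly_to_ac_mult)
    ultimately have "degree g = 0 \<or> degree h = 0"
      using factor[of g] factor[of h] gh by fastforce
    then show "is_unit g \<or> is_unit h"
      using nz by (simp add: is_unit_iff_degree)
  qed (use f in auto)
qed

section \<open>Periods of roots of field elements\<close>

lemma power_q_minus_one_eq_1:
  assumes "x ^ (q ^ k) = (x :: 'a alg_closure)" "x \<noteq> 0"
  shows "x ^ (q ^ k - 1) = 1"
proof -
  have "q ^ k > 0"
    by (simp add: q_def)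
  then have "x ^ (q ^ k) = x * x ^ (q ^ k - 1)"
    by (metis power_eq_if neq0_conv)
  with assms show ?thesis
    by simp
qed

lemma power_q_eqI:
  assumes "x ^ (q ^ k - 1) = (1 :: 'a alg_closure)"
  shows "x ^ (q ^ k) = x"
proof -
  have "q ^ k > 0"
    by (simp add: q_def)
  then have "x ^ (q ^ k) = x * x ^ (q ^ k - 1)"
    by (metis power_eq_if neq0_conv)
  with assms show ?thesis
    by simp
qed

lemma dvd_q_power_minus_one: "r dvd q - 1 \<Longrightarrow> r dvd q ^ k - (1 :: nat)"
proof -
  have "q > 0"
    by (simp add: q_def)
  then have "int (q ^ k - 1) = int q ^ k - 1" "int (q - 1) = int q - 1"
    by (simp_all add: of_nat_diff Suc_leI)
  moreover have "int q - 1 dvd int q ^ k - 1"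
    using power_diff_1_eq[of "int q" k] by (cases "int q = 1") auto
  ultimately have "q - 1 dvd q ^ k - 1"
    by (metis of_nat_dvd_iff)
  then show "r dvd q - 1 \<Longrightarrow> r dvd q ^ k - (1 :: nat)"
    by (rule dvd_trans[rotated])
qed

text \<open>With \<open>Q = q ^ D\<close>, the \<open>D\<close>-fold iterate of \<phi> multiplies
  \<open>v\<close> by \<open>z = v ^ (Q - 1)\<close>, a root of unity of exact order
  \<open>r\<close>; hence the factor \<open>r\<close> in the period. The second claim carries
  residue tests from \<open>v\<close> back to \<open>u\<close>, because the norm of \<open>v\<close>
  down to the field with \<open>Q\<close> elements is \<open>(- 1) ^ (r - 1) * u\<close>.\<close>

lemma power_prime_root_frob:
  assumes r: "prime r" "r dvd q - 1" and u: "v ^ r = (u :: 'a alg_closure)" "u \<noteq> 0"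
    and deg: "frob_degree u D" and nres: "u ^ ((q ^ D - 1) div r) \<noteq> 1"
  shows "frob_degree v (D * r)"
    and "s dvd q - 1 \<Longrightarrow>
      v ^ ((q ^ (D * r) - 1) div s) = ((- 1) ^ (r - 1) * u) ^ ((q ^ D - 1) div s)"
proof -
  define Q where "Q = q ^ D"
  define z where "z = v ^ (Q - 1)"
  have D: "D > 0" "u ^ Q = u"
    using deg by (auto simp: frob_degree_def q_def Q_def)
  have r0: "r > 0"
    using r prime_gt_0_nat by blast
  have v: "v \<noteq> 0"
    using u r0 by auto
  have rQ: "r dvd Q - 1"
    unfolding Q_def by (rule dvd_q_power_minus_one) fact
  have Q0: "Q > 0"
    by (simp add: Q_def q_def)
  have z_eq: "z = u ^ ((Q - 1) div r)"
    using rQ by (simp add: z_def flip: u(1) power_mult)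
  have z1: "z \<noteq> 1"
    using nres z_eq by (simp add: Q_def)
  have zr: "z ^ r = 1"
    using rQ power_q_minus_one_eq_1[of u D] D u by (simp add: z_eq Q_def flip: power_mult)
  \<comment> \<open>Since \<open>r\<close> divides \<open>q - 1\<close>, the root of unity
    \<open>z\<close> lies in the base field and is fixed by \<phi>.\<close>
  have "z ^ (q - 1) = 1"
    using zr r by (metis dvd_mult_div_cancel power_mult power_one)
  then have "z ^ (q ^ 1) = z"
    by (intro power_q_eqI) simp
  then have zQ: "z ^ Q = z"
    unfolding Q_def using frob_funpow[of z 1 D] by (simp add: q_def)
  have vQ: "v ^ Q = z * v"
    using Q0 by (metis z_def power_eq_if neq0_conv mult.commute)
  have conj: "v ^ (Q ^ k) = z ^ k * v" for k
  proof (induction k)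
    case (Suc k)
    have "v ^ (Q ^ Suc k) = (v ^ (Q ^ k)) ^ Q"
      by (simp only: power_Suc2 power_mult)
    also have "\<dots> = (z ^ Q) ^ k * v ^ Q"
      by (simp add: Suc.IH power_mult_distrib mult.commute flip: power_mult)
    finally show ?case
      by (simp add: zQ vQ)
  qed simp
  show "frob_degree v (D * r)"
  proof (rule frob_degreeI)
    show "D * r > 0"
      using D r0 by simp
    show "v ^ (q ^ (D * r)) = v"
      using conj[of r] zr by (simp add: Q_def q_def flip: power_mult)
    fix k assume k: "v ^ (q ^ k) = v"
    then have "u ^ (q ^ k) = u"
      by (metis u(1) power_mult mult.commute)
    then have "D dvd k"
      by (rule frob_degree_dvd[OF deg])
    then obtain j where j: "k = D * j"
      by auto
    then have "z ^ j = 1"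
      using conj[of j] v k by (simp add: Q_def q_def flip: power_mult)
    then have "r dvd j"
      using order_dvd_of_prime_power_eq_1 r zr z1 by blast
    then show "D * r dvd k"
      by (simp add: j)
  qed
  assume s: "s dvd q - 1"
  then have sQ: "s dvd Q - 1"
    unfolding Q_def by (rule dvd_q_power_minus_one)
  \<comment> \<open>The norm of \<open>v\<close> is the product of its conjugates
    \<open>z ^ i * v\<close>.\<close>
  have "v ^ (\<Sum>i<r. Q ^ i) = (\<Prod>i<r. z ^ i * v)"
    by (simp add: conj flip: prod_power_distinct_powers)
  also have "\<dots> = z ^ (\<Sum>i<r. i) * u"
    by (simp add: prod.distrib prod_power_distinct_powers u)
  also have "\<dots> = (- 1) ^ (r - 1) * u"
    using root_of_unity_power_triangle[OF r(1) zr z1] by simp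
  finally have norm: "v ^ (\<Sum>i<r. Q ^ i) = (- 1) ^ (r - 1) * u" .
  have "(q ^ (D * r) - 1) div s = (\<Sum>i<r. Q ^ i) * ((Q - 1) div s)"
    using nat_power_diff_1_eq[of Q r] sQ
    by (simp add: Q_def power_mult div_mult_swap mult.commute)
  then have "v ^ ((q ^ (D * r) - 1) div s) = ((- 1) ^ (r - 1) * u) ^ ((Q - 1) div s)"
    by (simp only: power_mult[of v] norm)
  then show "v ^ ((q ^ (D * r) - 1) div s) = ((- 1) ^ (r - 1) * u) ^ ((q ^ D - 1) div s)"
    by (simp only: Q_def)
qed

text \<open>One prime factor at a time. Only for the prime \<open>2\<close> does the norm of a root carry a sign,
  and \<open>4 dvd q - 1\<close> makes that sign disappear when the prime \<open>2\<close> is used again.\<close>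

lemma frob_degree_root:
  assumes "t ^ d = (u :: 'a alg_closure)" "u \<noteq> 0" "frob_degree u D" "d > 0"
    and "\<And>r. prime r \<Longrightarrow> r dvd d \<Longrightarrow> r dvd q - 1"
    and "\<And>r. prime r \<Longrightarrow> r dvd d \<Longrightarrow> u ^ ((q ^ D - 1) div r) \<noteq> 1"
    and "4 dvd d \<Longrightarrow> 4 dvd q - 1"
  shows "frob_degree t (D * d)"
  using assms
proof (induction d arbitrary: u D rule: less_induct)
  case (less d)
  show ?case
  proof (cases "d = 1")
    case True
    then show ?thesis
      using less.prems by simp
  next
    case False
    then obtain r where r: "prime r" "r dvd d"
      using prime_factor_nat by blast
    then obtain e where e: "d = r * e"
      by auto
    \<comment> \<open>One prime is split off: \<open>v\<close> is an \<open>r\<close>-th root of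
      \<open>u\<close>, and \<open>t\<close> is an \<open>e\<close>-th root of \<open>v\<close>, to
      which the induction hypothesis applies.\<close>
    define v where "v = t ^ e"
    have vr: "v ^ r = u"
      using less.prems(1) by (simp add: v_def e mult.commute flip: power_mult)
    have rq: "r dvd q - 1"
      using less.prems(5) r by blast
    note step = power_prime_root_frob[OF r(1) rq vr less.prems(2,3) less.prems(6)[OF r]]
    have "frob_degree t ((D * r) * e)"
    proof (rule less.IH)
      show "e < d" "e > 0"
        using \<open>d > 0\<close> r prime_gt_1_nat[of r] by (auto simp: e)
      show "t ^ e = v"
        by (simp add: v_def)
      show "v \<noteq> 0"
        using vr less.prems(2) prime_gt_0_nat[OF r(1)] by auto
      show "frob_degree v (D * r)"
        by (rule step)
      show "s dvd q - 1" if "prime s" "s dvd e" for s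
        using less.prems(5) that by (simp add: e)
      show "4 dvd q - 1" if "4 dvd e"
        using less.prems(7) that by (simp add: e)
      fix s assume s: "prime s" "s dvd e"
      have sq: "s dvd q - 1"
        using less.prems(5) s by (simp add: e)
      have sgn: "((- 1) ^ (r - 1)) ^ ((q ^ D - 1) div s) = (1 :: 'a alg_closure)"
      proof (cases "r = 2")
        case False
        then have "even (r - 1)"
          using r prime_odd_nat[of r] prime_ge_2_nat[of r] by auto
        then show ?thesis
          by simp
      next
        case r2: True
        have "even ((q ^ D - 1) div s)"
        proof (cases "s = 2")
          case True
          then have "4 dvd d"
            using s r2 by (auto simp: e elim!: dvdE)
          then have "4 dvd q ^ D - 1"
            using less.prems(7) dvd_q_power_minus_one by blast
          then show ?thesis
            using True by (auto elim!: dvdE)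
        next
          \<comment> \<open>Dividing the even number \<open>q ^ D - 1\<close> by an odd
            \<open>s\<close> removes no factor 2.\<close>
          case False
          then have "coprime 2 s"
            using s(1) by (metis primes_coprime two_is_prime_nat)
          moreover have "2 dvd q ^ D - 1" "s dvd q ^ D - 1"
            using rq r2 sq dvd_q_power_minus_one by blast+
          ultimately show ?thesis
            by (metis coprime_dvd_mult_right_iff dvd_mult_div_cancel)
        qed
        then show ?thesis
          by (simp add: power_mult[symmetric])
      qed
      have "v ^ ((q ^ (D * r) - 1) div s) = u ^ ((q ^ D - 1) div s)"
        unfolding step(2)[OF sq] power_mult_distrib sgn by simp
      then show "v ^ ((q ^ (D * r) - 1) div s) \<noteq> 1"
        using less.prems(6)[of s] s by (simp add: e)
    qed
    then show ?thesis
      by (simp add: e mult.assoc)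
  qed
qed

text \<open>If \<open>u\<close> passed the residue test for \<open>r\<close>, then
  \<open>v = t ^ e\<close> with \<open>d = r * e\<close> would lie in the field with
  \<open>q ^ D\<close> elements. The iterates of \<open>t\<close> under the \<open>D\<close>-fold
  \<phi> would stay among the at most \<open>e\<close> roots of \<open>X ^ e - v\<close>, so the
  period of \<open>t\<close> would be at most \<open>D * e\<close>. If \<open>u = 0\<close>, then
  \<open>t = 0\<close> and its period is 1.\<close>

lemma frob_degree_rootD:
  assumes t: "t ^ d = (u :: 'a alg_closure)" and deg: "frob_degree u D" "frob_degree t (D * d)"
    and r: "prime r" "r dvd d" "r dvd q - 1"
  shows "u \<noteq> 0" "u ^ ((q ^ D - 1) div r) \<noteq> 1"
proof -
  obtain e where e: "d = r * e"
    using r by auto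
  have D: "D > 0" "D * d > 0"
    using deg by (auto simp: frob_degree_def)
  then have e0: "e > 0"
    using e by (auto intro: gr0I)
  have ed: "e < d"
    using e0 prime_gt_1_nat[OF r(1)] by (simp add: e)
  have min: "t ^ (q ^ (D * k)) \<noteq> t" if "0 < k" "k < d" for k
    using deg(2) D that by (auto simp: frob_degree_def q_def)
  show "u \<noteq> 0"
  proof
    assume "u = 0"
    then have "t = 0"
      using t by auto
    then show False
      using min[of e] e0 ed by (simp add: q_def power_0_left)
  qed
  show "u ^ ((q ^ D - 1) div r) \<noteq> 1"
  proof
    assume u1: "u ^ ((q ^ D - 1) div r) = 1"
    define v where "v = t ^ e"
    have "u = v ^ r"
      using t by (simp add: v_def e mult.commute flip: power_mult)
    then have "v ^ (q ^ D - 1) = 1"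
      using u1 dvd_q_power_minus_one[OF r(3), of D] by (simp flip: power_mult)
    then have vQ: "v ^ (q ^ D) = v"
      by (rule power_q_eqI)
    let ?p = "monom 1 e - [:v:]"
    have degp: "degree ?p \<le> e"
      by (intro degree_diff_le) (simp_all add: degree_monom_le)
    have "coeff ?p e = 1"
      using e0 by (cases e) simp_all
    then have nz: "?p \<noteq> 0"
      by (metis coeff_0 zero_neq_one)
    have "t ^ (q ^ (D * i)) \<in> {x. poly ?p x = 0}" for i
    proof -
      have "(t ^ (q ^ (D * i))) ^ e = v ^ (q ^ (D * i))"
        by (simp add: v_def mult.commute flip: power_mult)
      also have "\<dots> = v"
        using frob_funpow[of v D i] vQ by (simp add: q_def)
      finally show ?thesis
        by (simp add: poly_monom q_def)
    qed
    from frob_coincide_if_finite[OF poly_roots_finite[OF nz] this]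
    obtain j where j: "0 < j" "j \<le> card {x. poly ?p x = 0}" "t ^ (q ^ (D * j)) = t"
      by (auto simp: q_def)
    then have "j < d"
      using card_poly_roots_bound[OF nz] degp ed by linarith
    with j min show False
      by blast
  qed
qed

section \<open>Euler's criterion and norms\<close>

text \<open>For the converse an \<open>r\<close>-th root \<open>y\<close> is taken in the algebraic
  closure; the criterion says \<open>y ^ (q - 1) = 1\<close>, which puts \<open>y\<close> in the
  base field.\<close>

lemma is_nth_power_iff_euler:
  assumes r: "r dvd q - 1"
  shows "is_nth_power r (x :: 'a) \<longleftrightarrow> x = 0 \<or> x ^ ((q - 1) div r) = 1"
proof -
  have q: "q > 1"
    using CARD_field_ge_2[where ?'a = 'a] by (simp add: q_def)
  then have r0: "r > 0"
    using r by (auto intro: gr0I)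
  have unit: "y ^ (q - 1) = 1" if "y \<noteq> 0" for y :: 'a
  proof -
    have "y * y ^ (q - 1) = y"
      using fermat_finite_field[of y] q by (metis q_def power_eq_if not_less0)
    with that show ?thesis by simp
  qed
  show ?thesis
  proof
    assume "is_nth_power r x"
    then obtain y where "x = y ^ r"
      by (auto elim: is_nth_powerE)
    then show "x = 0 \<or> x ^ ((q - 1) div r) = 1"
      using r unit[of y] r0 by (cases "y = 0") (simp_all flip: power_mult)
  next
    assume "x = 0 \<or> x ^ ((q - 1) div r) = 1"
    then show "is_nth_power r x"
    proof
      assume x: "x ^ ((q - 1) div r) = 1"
      obtain y :: "'a alg_closure" where y: "y ^ r = to_ac x"
        using nth_root_exists[OF r0] by blast
      have "y ^ (q - 1) = to_ac (x ^ ((q - 1) div r))"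
        using r by (simp flip: y power_mult)
      then have "y ^ (q ^ 1) = y"
        unfolding x by (intro power_q_eqI) simp
      then have "y \<in> range to_ac"
        using frob_fixed_iff[of y] by (simp add: q_def)
      then obtain w where "y = to_ac w"
        by auto
      with y show ?thesis
        by (intro is_nth_powerI[of _ w]) (simp flip: to_ac_power)
    qed (use r0 in simp)
  qed
qed

text \<open>\<phi> fixes \<open>a\<close> and \<open>c\<close>, so it commutes with this invertible
  affine map.\<close>

lemma frob_degree_affine:
  assumes "x = to_ac a * u + to_ac c" "(a :: 'a) \<noteq> 0" "frob_degree x D"
  shows "frob_degree u D"
proof -
  have "x ^ (q ^ k) = to_ac a * u ^ (q ^ k) + to_ac c" for k
    by (simp add: assms(1) frob_add power_mult_distrib)
  then have "x ^ (q ^ k) = x \<longleftrightarrow> u ^ (q ^ k) = u" for k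
    using assms(1,2) by simp
  then show ?thesis
    using assms(3) by (simp add: frob_degree_def q_def)
qed

text \<open>The left side is the norm of \<open>u\<close>. Evaluating the factorization of
  \<open>f\<close> into conjugates at \<open>c\<close> turns each factor into \<open>- a\<close>
  times a conjugate of \<open>u\<close>.\<close>

lemma norm_affine:
  fixes f :: "'a poly"
  assumes root: "poly (map_poly to_ac f) x = 0" and deg: "frob_degree x (degree f)"
    and x: "x = to_ac a * u + to_ac c" and a: "a \<noteq> 0"
  shows "u ^ (\<Sum>i<degree f. q ^ i) =
    to_ac ((- 1) ^ degree f * (poly f c / (lead_coeff f * a ^ degree f)))"
proof -
  have f: "f \<noteq> 0"
    using deg by (auto simp: frob_degree_def)
  have "to_ac (poly f c) = poly (map_poly to_ac f) (to_ac c)"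
    by simp
  also have "\<dots> = to_ac (lead_coeff f) * (\<Prod>i<degree f. to_ac c - x ^ (q ^ i))"
    unfolding map_poly_to_ac_eq_prod_conjugates[OF root deg] by (simp add: poly_prod)
  also have "(\<Prod>i<degree f. to_ac c - x ^ (q ^ i)) = (\<Prod>i<degree f. (- to_ac a) * u ^ (q ^ i))"
    by (simp add: x frob_add power_mult_distrib)
  also have "\<dots> = (- to_ac a) ^ degree f * u ^ (\<Sum>i<degree f. q ^ i)"
    by (simp only: prod.distrib prod_power_distinct_powers) simp
  also have "(- to_ac a) ^ degree f = (- 1) ^ degree f * to_ac a ^ degree f"
    by (rule power_minus)
  finally have "to_ac (poly f c) = to_ac (lead_coeff f) * ((- 1) ^ degree f * to_ac a ^ degree f *
      u ^ (\<Sum>i<degree f. q ^ i))" .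
  moreover have "(- 1) ^ degree f * (- 1) ^ degree f = (1 :: 'a alg_closure)"
    by (simp flip: power_mult_distrib)
  ultimately show ?thesis
    using a f by (simp add: field_simps)
qed

text \<open>The exponent \<open>(q ^ degree f - 1) div r\<close> is the norm exponent times
  \<open>(q - 1) div r\<close>, so the test for \<open>u\<close> becomes Euler's criterion for its
  norm in the base field.\<close>

lemma nonresidue_iff_norm:
  fixes f :: "'a poly"
  assumes root: "poly (map_poly to_ac f) x = 0" and deg: "frob_degree x (degree f)"
    and x: "x = to_ac a * u + to_ac c" and a: "a \<noteq> 0" and r: "r dvd q - 1"
  shows "u \<noteq> 0 \<and> u ^ ((q ^ degree f - 1) div r) \<noteq> 1 \<longleftrightarrow>
    \<not> is_nth_power r ((- 1) ^ degree f * (poly f c / (lead_coeff f * a ^ degree f)))"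
    (is "_ \<longleftrightarrow> \<not> is_nth_power r ?y")
proof -
  define S where "S = (\<Sum>i<degree f. q ^ i)"
  have y: "u ^ S = to_ac ?y"
    unfolding S_def by (rule norm_affine) fact+
  obtain m where m: "degree f = Suc m"
    using deg by (cases "degree f") (auto simp: frob_degree_def)
  have "S \<noteq> 0"
    by (simp add: S_def m lessThan_Suc q_def)
  then have "u = 0 \<longleftrightarrow> ?y = 0"
    using y by (metis power_eq_0_iff to_ac_eq_0_iff gr0I)
  moreover have "(q ^ degree f - 1) div r = S * ((q - 1) div r)"
    using nat_power_diff_1_eq[of q "degree f"] r by (simp add: S_def div_mult_swap mult.commute)
  then have "u ^ ((q ^ degree f - 1) div r) = to_ac (?y ^ ((q - 1) div r))"
    by (simp only: power_mult y to_ac_power)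
  then have "u ^ ((q ^ degree f - 1) div r) = 1 \<longleftrightarrow> ?y ^ ((q - 1) div r) = 1"
    by (simp only: to_ac_1[symmetric] to_ac_eq_iff)
  ultimately show ?thesis
    using is_nth_power_iff_euler[OF r, of ?y] by blast
qed

text \<open>One step of the backward orbit: \<open>t\<close> is a preimage of \<open>x\<close>, and
  the growth of the period by the full factor \<open>d\<close> is decided in the base field.\<close>

lemma frob_degree_preimage_iff:
  fixes f :: "'a poly"
  assumes root: "poly (map_poly to_ac f) x = 0" and deg: "frob_degree x (degree f)"
    and x: "x = to_ac a * t ^ d + to_ac c" and a: "a \<noteq> 0" and d: "d \<ge> 2"
    and prime_dvd: "\<And>r. prime r \<Longrightarrow> r dvd d \<Longrightarrow> r dvd q - 1"
    and four_dvd: "4 dvd d \<Longrightarrow> 4 dvd q - 1"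
  shows "frob_degree t (degree f * d) \<longleftrightarrow> (\<forall>r. prime r \<and> r dvd d \<longrightarrow>
    \<not> is_nth_power r ((- 1) ^ degree f * (poly f c / (lead_coeff f * a ^ degree f))))"
    (is "_ \<longleftrightarrow> ?rhs")
proof -
  have u: "frob_degree (t ^ d) (degree f)"
    using x a deg by (rule frob_degree_affine)
  have rhs: "?rhs \<longleftrightarrow>
      (\<forall>r. prime r \<and> r dvd d \<longrightarrow> t ^ d \<noteq> 0 \<and> (t ^ d) ^ ((q ^ degree f - 1) div r) \<noteq> 1)"
    using nonresidue_iff_norm[OF root deg x a] prime_dvd by blast
  show ?thesis
  proof
    assume "frob_degree t (degree f * d)"
    then show ?rhs
      unfolding rhs using frob_degree_rootD[OF refl u] prime_dvd by blast
  next
    assume *: ?rhs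
    \<comment> \<open>That \<open>t ^ d\<close> is nonzero is asserted only for primes dividing
      \<open>d\<close>; one exists because \<open>d \<ge> 2\<close>.\<close>
    obtain r where "prime r" "r dvd d"
      using d prime_factor_nat[of d] by auto
    with * have "t ^ d \<noteq> 0"
      unfolding rhs by blast
    with * show "frob_degree t (degree f * d)"
      unfolding rhs using d prime_dvd four_dvd u by (intro frob_degree_root[OF refl]) auto
  qed
qed

end

section \<open>Iterates and backward orbits\<close>

lemma map_poly_to_ac_pcompose:
  "map_poly to_ac (pcompose p r) = pcompose (map_poly to_ac p) (map_poly to_ac r)"
  by (induction p)
    (simp_all add: pcompose_pCons map_poly_pCons map_poly_add_hom map_poly_to_ac_mult)

lemma map_poly_to_ac_diff:
  "map_poly to_ac (p - r) = map_poly to_ac p - map_poly to_ac r"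
  by (intro poly_eqI) (simp add: coeff_map_poly)

lemma poly_iterate_0: "poly_iterate h 0 = [:0, 1:]"
  by (simp add: poly_iterate_def)

lemma poly_iterate_Suc: "poly_iterate h (Suc n) = pcompose h (poly_iterate h n)"
  by (simp add: poly_iterate_def)

lemma poly_map_poly_to_ac_iterate:
  "poly (map_poly to_ac (poly_iterate h n)) x = (poly (map_poly to_ac h) ^^ n) x"
  by (induction n)
    (simp_all add: poly_iterate_0 poly_iterate_Suc map_poly_to_ac_pcompose poly_pcompose map_poly_pCons)

lemma degree_poly_iterate: "degree (poly_iterate (h :: 'a::field poly) n) = degree h ^ n"
  by (induction n) (simp_all add: poly_iterate_0 poly_iterate_Suc degree_pcompose)

lemma lead_coeff_poly_iterate_Suc:
  fixes h :: "'a::field poly"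
  assumes "degree h > 0"
  shows "lead_coeff (poly_iterate h (Suc n)) = lead_coeff h * lead_coeff (poly_iterate h n) ^ degree h"
  using assms by (simp only: poly_iterate_Suc) (subst lead_coeff_comp, simp_all add: degree_poly_iterate)

lemma degree_diff_const: "degree (p - [:b:]) = degree (p :: 'a::comm_ring_1 poly)"
proof (cases "degree p = 0")
  case True
  then show ?thesis
    by (auto elim: degree_eq_zeroE)
next
  case False
  have eq: "p - [:b:] = p + [:- b:]"
    by (rule poly_eqI) (simp add: coeff_pCons split: nat.splits)
  from False show ?thesis
    using degree_add_eq_left[of "[:- b:]" p] by (simp add: eq)
qed

lemma lead_coeff_diff_const:
  "degree p > 0 \<Longrightarrow> lead_coeff (p - [:b:]) = lead_coeff (p :: 'a::comm_ring_1 poly)"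
  by (simp add: degree_diff_const coeff_pCons split: nat.splits)

lemma is_nth_power_mult_iff:
  fixes x s :: "'a::field"
  assumes "s \<noteq> 0"
  shows "is_nth_power r (x * s ^ r) \<longleftrightarrow> is_nth_power r x"
proof
  assume "is_nth_power r (x * s ^ r)"
  then obtain y where "x * s ^ r = y ^ r"
    by (auto elim: is_nth_powerE)
  then have "x = (y / s) ^ r"
    using assms by (simp add: field_simps)
  then show "is_nth_power r x"
    by (rule is_nth_powerI)
next
  assume "is_nth_power r x"
  then show "is_nth_power r (x * s ^ r)"
    by (auto elim!: is_nth_powerE simp flip: power_mult_distrib)
qed

text \<open>Over an algebraically closed field \<open>h\<close> is surjective, so iterating a chosen
  right inverse from \<open>b\<close> gives the orbit.\<close>

lemma backward_orbit_exists:
  fixes h :: "'a::field poly"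
  assumes "degree h > 0"
  shows "\<exists>t. t 0 = b \<and> (\<forall>n. poly (map_poly to_ac h) (t (Suc n)) = t n)"
proof -
  have "\<exists>z. poly (map_poly to_ac h) z = y" for y
    using alg_closed_imp_poly_has_root[of "map_poly to_ac h - [:y:]"] assms
    by (auto simp: degree_diff_const)
  then obtain g where g: "\<And>y. poly (map_poly to_ac h) (g y) = y"
    by metis
  show ?thesis
    by (intro exI[of _ "\<lambda>n. (g ^^ n) b"]) (simp add: g)
qed

text \<open>The point \<open>t n\<close> is a root of \<open>f n\<close>, which has degree
  \<open>d ^ n\<close>, so irreducibility at level \<open>n\<close> means that its period is
  \<open>d ^ n\<close>. The condition \<open>?N n\<close> decides the passage from level
  \<open>n\<close> to level \<open>n + 1\<close>.\<close>

lemma dynamically_irreducible_iff: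
  fixes a c b :: "'a::{field,finite}"
  assumes d: "d \<ge> 2" and h: "h = monom a d + [:c:]" and a: "a \<noteq> 0"
    and prime_dvd: "\<And>r. prime r \<Longrightarrow> r dvd d \<Longrightarrow> r dvd CARD('a) - 1"
    and four_dvd: "4 dvd d \<Longrightarrow> 4 dvd CARD('a) - 1"
  shows "dynamically_irreducible h b \<longleftrightarrow> (\<forall>n r. prime r \<and> r dvd d \<longrightarrow>
    \<not> is_nth_power r ((- 1) ^ (d ^ n) *
      ((poly (poly_iterate h n) c - b) / (lead_coeff (poly_iterate h n) * a ^ (d ^ n)))))"
    (is "_ \<longleftrightarrow> (\<forall>n. ?N n)")
proof -
  have deg_h: "degree h = d"
    unfolding h using d a by (subst degree_add_eq_left) (simp_all add: degree_monom_eq)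
  obtain t where t0: "t 0 = to_ac b" and t: "\<And>n. poly (map_poly to_ac h) (t (Suc n)) = t n"
    using backward_orbit_exists[of h "to_ac b"] deg_h d by auto
  define f where "f n = poly_iterate h n - [:b:]" for n
  have deg_f: "degree (f n) = d ^ n" for n
    by (simp add: f_def degree_diff_const degree_poly_iterate deg_h)
  have lead_f: "lead_coeff (f n) = lead_coeff (poly_iterate h n)" for n
    unfolding f_def using d by (intro lead_coeff_diff_const) (simp add: degree_poly_iterate deg_h)
  have poly_f: "poly (f n) c = poly (poly_iterate h n) c - b" for n
    by (simp add: f_def)
  have f_nz: "f n \<noteq> 0" for n
    using deg_f[of n] d by (metis degree_0 power_eq_0_iff not_numeral_le_zero)
  have "(poly (map_poly to_ac h) ^^ n) (t n) = to_ac b" for n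
    by (induction n) (simp_all add: t0 t funpow_swap1)
  then have root: "poly (map_poly to_ac (f n)) (t n) = 0" for n
    by (simp add: f_def map_poly_to_ac_diff map_poly_pCons poly_map_poly_to_ac_iterate)
  have irr: "irreducible (f n) \<longleftrightarrow> frob_degree (t n) (d ^ n)" for n
    using irreducible_iff_frob_degree[OF root f_nz] by (simp add: deg_f)
  have t_eq: "t n = to_ac a * t (Suc n) ^ d + to_ac c" for n
    using t[of n] by (simp add: h map_poly_add_hom map_poly_monom map_poly_pCons poly_monom)
  have step: "frob_degree (t (Suc n)) (d ^ Suc n) \<longleftrightarrow> ?N n" if "frob_degree (t n) (d ^ n)" for n
    using frob_degree_preimage_iff[OF root[of n] _ t_eq a d prime_dvd four_dvd] that
    unfolding deg_f lead_f[unfolded deg_f] poly_f by (simp only: power_Suc2)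
  \<comment> \<open>Level 0 belongs to the linear polynomial \<open>x - b\<close>; it starts the
    induction, although dynamical irreducibility speaks of positive levels.\<close>
  have base: "frob_degree (t 0) (d ^ 0)"
    by (auto simp: t0 frob_degree_def)
  have "(\<forall>n>0. frob_degree (t n) (d ^ n)) \<longleftrightarrow> (\<forall>n. frob_degree (t n) (d ^ n))"
  proof (intro iffI allI)
    fix n assume "\<forall>n>0. frob_degree (t n) (d ^ n)"
    then show "frob_degree (t n) (d ^ n)"
      using base by (cases "n = 0") auto
  qed auto
  also have "\<dots> \<longleftrightarrow> (\<forall>n. ?N n)"
  proof
    assume "\<forall>n. frob_degree (t n) (d ^ n)"
    with step show "\<forall>n. ?N n"
      by blast
  next
    assume N: "\<forall>n. ?N n"
    have "frob_degree (t n) (d ^ n)" for n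
    proof (induction n)
      case 0
      show ?case by (rule base)
    next
      case (Suc n)
      with step N show ?case by blast
    qed
    then show "\<forall>n. frob_degree (t n) (d ^ n)" ..
  qed
  finally show ?thesis
    unfolding dynamically_irreducible_def by (simp only: irr[unfolded f_def])
qed

section \<open>The norm conditions up to \<open>r\<close>-th powers\<close>

text \<open>At positive levels the leading coefficient is \<open>a\<close> times a
  \<open>d\<close>-th power and the exponent \<open>d ^ Suc n\<close> is a multiple of
  \<open>r\<close>, so apart from \<open>1 / a\<close> everything multiplying \<open>y\<close> is an
  \<open>r\<close>-th power.\<close>

lemma is_nth_power_norm_iff:
  fixes a c b :: "'a::field"
  assumes d: "d \<ge> 2" and h: "h = monom a d + [:c:]" and a: "a \<noteq> 0" and r: "r dvd d"
  shows "is_nth_power r ((- 1) ^ (d ^ Suc n) * (y / (lead_coeff (poly_iterate h (Suc n)) * a ^ (d ^ Suc n))))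
    \<longleftrightarrow> is_nth_power r (y / a)"
proof -
  obtain e where e: "d = e * r"
    using r by (metis dvdE mult.commute)
  have deg_h: "degree h = d"
    unfolding h using d a by (subst degree_add_eq_left) (simp_all add: degree_monom_eq)
  have lead_h: "coeff h d = a"
    using d by (simp add: h coeff_pCons split: nat.splits)
  define A where "A = lead_coeff (poly_iterate h n)"
  have "A \<noteq> 0"
    unfolding A_def leading_coeff_0_iff using degree_poly_iterate[of h n] d deg_h
    by (metis poly_iterate_0 poly_iterate_Suc degree_0 power_eq_0_iff not_numeral_le_zero)
  define m where "m = d ^ n * e"
  have m: "d ^ Suc n = m * r"
    by (simp add: m_def e)
  \<comment> \<open>\<open>s\<close> is the explicit \<open>r\<close>-th root of the sign and of the
    denominator without its single factor \<open>a\<close>.\<close>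
  define s where "s = (- 1) ^ m / (A ^ e * a ^ m)"
  have "lead_coeff (poly_iterate h (Suc n)) = a * A ^ d"
    using lead_coeff_poly_iterate_Suc[of h n] d by (simp add: deg_h lead_h A_def)
  then have "(- 1) ^ (d ^ Suc n) * (y / (lead_coeff (poly_iterate h (Suc n)) * a ^ (d ^ Suc n)))
      = (y / a) * s ^ r"
    unfolding m by (simp add: s_def e power_mult power_divide power_mult_distrib mult_ac)
  moreover have "s \<noteq> 0"
    using \<open>A \<noteq> 0\<close> a by (simp add: s_def)
  ultimately show ?thesis
    using is_nth_power_mult_iff by metis
qed

theorem theorem13:
  fixes a c \<beta> :: "'a::{field,finite}"
    and d q :: nat
    and h :: "'a poly"
  assumes d: "d \<ge> 2"
    and q: "q = CARD('a)"
    and h: "h = monom a d + [:c:]"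
    and a: "a \<noteq> 0"
    and cong_prime: "\<And>r. prime r \<Longrightarrow> r dvd d \<Longrightarrow> [q = 1] (mod r)"
    and cong_4: "4 dvd d \<Longrightarrow> [q = 1] (mod 4)"
  shows "dynamically_irreducible h \<beta> \<longleftrightarrow>
    (\<forall>r. prime r \<and> r dvd d \<longrightarrow>
        \<not> is_nth_power r (- (c - \<beta>) / a) \<and>
        (\<forall>n>1. \<not> is_nth_power r ((poly (poly_iterate h (n - 1)) c - \<beta>) / a))) \<and>
    (4 dvd d \<longrightarrow>
        \<not> is_nth_power 4 ((c - \<beta>) / (4 * a)) \<and>
        (\<forall>n>1. \<not> is_nth_power 4 ((poly (poly_iterate h (n - 1)) c - \<beta>) / a)))"
    (is "_ \<longleftrightarrow> ?P \<and> (4 dvd d \<longrightarrow> ?F)")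
proof -
  have q2: "q \<ge> 2"
    using CARD_field_ge_2[where ?'a = 'a] q by simp
  have cong_dvd: "r dvd q - 1" if "[q = 1] (mod r)" for r
    using that q2 by (metis cong_altdef_nat cong_sym one_le_numeral le_trans)
  have prime_dvd: "r dvd CARD('a) - 1" if "prime r" "r dvd d" for r
    using cong_dvd cong_prime that q by blast
  have four_dvd: "4 dvd CARD('a) - 1" if "4 dvd d"
    using cong_dvd cong_4 that q by blast
  let ?N = "\<lambda>n. (- 1) ^ (d ^ n) *
      ((poly (poly_iterate h n) c - \<beta>) / (lead_coeff (poly_iterate h n) * a ^ (d ^ n)))"
  \<comment> \<open>Here \<open>d ^ 0 = 1\<close>, so the sign survives; this is the source of the
    minus in the first condition.\<close>
  have N0: "?N 0 = - (c - \<beta>) / a"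
    by (simp add: poly_iterate_0)
  have NSuc: "is_nth_power r (?N (Suc n)) \<longleftrightarrow>
      is_nth_power r ((poly (poly_iterate h (Suc n)) c - \<beta>) / a)" if "r dvd d" for r n
    by (rule is_nth_power_norm_iff[OF d h a that])
  have P_iff: "(\<forall>n r. prime r \<and> r dvd d \<longrightarrow> \<not> is_nth_power r (?N n)) \<longleftrightarrow> ?P"
  proof safe
    fix r assume *: "\<forall>n r. prime r \<and> r dvd d \<longrightarrow> \<not> is_nth_power r (?N n)" "prime r" "r dvd d"
    show False if "is_nth_power r (- (c - \<beta>) / a)"
      using * that N0 by metis
    show False if "n > 1" "is_nth_power r ((poly (poly_iterate h (n - 1)) c - \<beta>) / a)" for n
      \<comment> \<open>The theorem indexes the conditions by \<open>n > 1\<close> and uses the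
        iterate \<open>n - 1\<close>, hence \<open>Suc (n - 2)\<close>.\<close>
      using * that NSuc[of r "n - 2"] by (metis Suc_diff_Suc Suc_1 diff_Suc_1' One_nat_def)
  next
    fix n r assume *: ?P "prime r" "r dvd d" and N: "is_nth_power r (?N n)"
    show False
    proof (cases n)
      case 0
      then show False
        using * N N0 by metis
    next
      case (Suc m)
      then have "is_nth_power r ((poly (poly_iterate h (Suc (Suc m) - 1)) c - \<beta>) / a)"
        using N NSuc * by simp
      moreover have "Suc (Suc m) > 1"
        by simp
      ultimately show False
        using * by blast
    qed
  qed
  text \<open>A fourth power is a square, and \<open>- 4\<close> is a square because \<open>q \<equiv> 1 (mod 4)\<close>; hence the
    conditions for \<open>r = 2\<close> imply those for fourth powers.\<close>
  have F: ?F if P: ?P and d4: "4 dvd d"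
  proof -
    have square: "is_nth_power 2 x" if "is_nth_power 4 x" for x :: 'a
    proof -
      from that obtain y where "x = y ^ 4"
        by (auto elim: is_nth_powerE)
      then have "x = (y ^ 2) ^ 2"
        by (simp flip: power_mult)
      then show ?thesis
        by (rule is_nth_powerI)
    qed
    have d2: "2 dvd d"
      using d4 by (metis dvd_trans even_numeral)
    note P2 = P[rule_format, of 2]
    obtain m where m: "CARD('a) - 1 = 4 * m"
      using four_dvd d4 by auto
    have "(CARD('a) - 1) div 2 = 2 * m"
      by (simp only: m)
    then have "(- 1 :: 'a) ^ ((CARD('a) - 1) div 2) = 1"
      by (simp only: power_mult power2_minus power_one)
    moreover have "2 dvd CARD('a) - 1"
      unfolding m by simp
    ultimately have "is_nth_power 2 (- 1 :: 'a)"
      using is_nth_power_iff_euler by blast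
    then obtain i :: 'a where i: "i ^ 2 = - 1"
      by (metis is_nth_powerE)
    \<comment> \<open>In characteristic 2 the field would have even cardinality, against
      \<open>4 dvd q - 1\<close>.\<close>
    have "(2 :: 'a) \<noteq> 0"
    proof
      assume "(2 :: 'a) = 0"
      then have "CHAR('a) dvd 2"
        by (metis of_nat_eq_0_iff_char_dvd of_nat_numeral)
      then have "CHAR('a) = 2"
        using two_is_prime_nat CHAR_not_1[where ?'a = 'a] by (auto simp: prime_nat_iff)
      then have "even (CARD('a))"
        using CHAR_dvd_CARD[where ?'a = 'a] by metis
      then show False
        using m q q2 by presburger
    qed
    then have four: "(4 :: 'a) \<noteq> 0"
      by (metis mult_eq_0_iff mult_2 numeral_Bit0)
    have "\<not> is_nth_power 4 ((c - \<beta>) / (4 * a))"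
    proof
      assume "is_nth_power 4 ((c - \<beta>) / (4 * a))"
      then obtain y where "(c - \<beta>) / (4 * a) = y ^ 4"
        by (auto elim: is_nth_powerE)
      then have "(c - \<beta>) / a = 4 * y ^ 4"
        using four a by (simp add: field_simps)
      \<comment> \<open>With \<open>i\<close> a square root of \<open>- 1\<close>, the element
        \<open>- 4 * y ^ 4\<close> is the square of \<open>2 * i * y ^ 2\<close>.\<close>
      then have "- (c - \<beta>) / a = (- 1) * (4 * y ^ 4)"
        by (metis minus_divide_left mult_minus1)
      also have "\<dots> = (2 * i * y ^ 2) ^ 2"
        by (simp add: power_mult_distrib i flip: power_mult)
      finally have "is_nth_power 2 (- (c - \<beta>) / a)"
        by (rule is_nth_powerI)
      then show False
        using P2 d2 by simp
    qed
    then show ?F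
      using P2 d2 square by (metis two_is_prime_nat)
  qed
  show ?thesis
    using dynamically_irreducible_iff[OF d h a prime_dvd four_dvd] P_iff F by blast
qed

end
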